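(* Consider the optimal power flow linear program $$J^*(\boldsymbol\ell)=\min_{\mathbf x\in\mathbb R^n,\ \mathbf f\in\mathbb R^{n-1}}\ \mathbf c^T\mathbf x\quad\text{s.t.}\quad \mathbf 0\le \mathbf x\le \bar{\mathbf x},\qquad -\underline{\mathbf f}\le \mathbf K\mathbf f\le \bar{\mathbf f},\qquad \mathbf x+\tilde{\mathbf A}\mathbf f=\boldsymbol\ell,$$ regarded as a function of the load vector $\boldsymbol\ell\in\mathbb R^n$. Let $\boldsymbol\mu^*\in\mathbb R^n$ denote the optimal dual variables associated with the equality constraints $\mathbf x+\tilde{\mathbf A}\mathbf f=\boldsymbol\ell$. Suppose that for the given $\boldsymbol\ell$ the program is feasible, and that it is nondegenerate. Then $$\nabla_{\boldsymbol\ell}J^*=\boldsymbol\mu^*.$$ Furthermore, the optimal solution of the program is associated with the following active/inactive constraints: for every $i=1,\dots,n$, $$x_i=\bar x_i\ \text{ if } \mu_i^*-c_i>0,\qquad x_i=0\ \text{ if } \mu_i^*-c_i<0,\qquad x_i\in(0,\bar x_i)\ \text{ otherwise.}$$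
   Context: Setting: a connected graph with $n$ nodes and $m$ edges. $x_i$ is the production at node $i$, $l_i$ (the $i$-th entry of $\boldsymbol\ell$) is its load, $c_i>0$ is its unit production cost, and $\bar x_i$ is its production capacity. The vector $\mathbf f\in\mathbb R^{n-1}$ collects the fundamental flows, i.e. the flows on the edges of a chosen spanning tree. The matrix $\mathbf K\in\mathbb R^{m\times(n-1)}$ maps the fundamental flows to the flows on all $m$ edges (the rows of $\mathbf K$ for the spanning-tree edges form an identity matrix; the other flows are determined linearly by the cycle constraints of the network). $-\underline{\mathbf f},\bar{\mathbf f}\in\mathbb R^m$ are the lower and upper edge flow capacities, and $\tilde{\mathbf A}\in\mathbb R^{n\times(n-1)}$ is the modified incidence matrix mapping fundamental flows to nodal injections. Vector inequalities are componentwise. Dual sign convention: the Lagrangian is $$\mathbf c^T\mathbf x+\boldsymbol\mu^T(\boldsymbol\ell-\mathbf x-\tilde{\mathbf A}\mathbf f)+\bar{\boldsymbol\lambda}^T(\mathbf K\mathbf f-\bar{\mathbf f})-\underline{\boldsymbol\lambda}^T(\mathbf K\mathbf f+\underline{\mathbf f})-\underline{\boldsymbol\nu}^T\mathbf x+\bar{\boldsymbol\nu}^T(\mathbf x-\bar{\mathbf x}),$$ with $\bar{\boldsymbol\lambda},\underline{\boldsymbol\lambda},\bar{\boldsymbol\nu},\underline{\boldsymbol\nu}\ge\mathbf 0$ and $\boldsymbol\mu$ free. Nondegeneracy: a constraint is active at the optimal solution if it is an equality constraint or an inequality constraint holding with equality there. The program (with $p=2n-1$ variables) is nondegenerate if it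 has a unique optimal solution and exactly $p$ constraints are active at it, these $p$ active constraints being linearly independent. *)

theory Defs
  imports "HOL-Analysis.Analysis" "Graph_Theory.Digraph_Component"
begin

text \<open>
  An undirected (multi)graph is represented by a digraph that fixes one arbitrary reference
  orientation for every edge; its nodes are all elements of the type \<open>'n\<close>, its edges
  a subset of the type \<open>'e\<close>.  The predicates \<open>forest\<close> and \<open>tree\<close> of the graph library refer to
  directed cycles and are therefore not applicable here; an undirected cycle is a set
  of edges that becomes a directed cycle after reversing some of the edges.
\<close>

definition reverse_arcs :: "'e set \<Rightarrow> ('n, 'e) pre_digraph \<Rightarrow> ('n, 'e) pre_digraph" where
  "reverse_arcs R G = G\<lparr>tail := (\<lambda>e. if e \<in> R then head G e else tail G e),
                        head := (\<lambda>e. if e \<in> R then tail G e else head G e)\<rparr>"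

definition undirected_cycle :: "('n, 'e) pre_digraph \<Rightarrow> 'e set \<Rightarrow> bool" where
  "undirected_cycle G C \<longleftrightarrow> (\<exists>R p. pre_digraph.cycle (reverse_arcs R G) p \<and> C = set p)"

definition undirected_spanning_tree :: "('n, 'e) pre_digraph \<Rightarrow> 'e set \<Rightarrow> bool" where
  "undirected_spanning_tree G T \<longleftrightarrow>
     T \<subseteq> arcs G \<and> Digraph_Component.connected (G\<lparr>arcs := T\<rparr>) \<and> (\<nexists>C. undirected_cycle (G\<lparr>arcs := T\<rparr>) C)"

text \<open>
  The net flow into a node is positive along incoming edges, so that \<open>x + A f = l\<close>
  says that production plus inflow equals load.
\<close>

definition incidence :: "('n::finite, 'e::finite) pre_digraph \<Rightarrow> real^'e^'n" where
  "incidence G = (\<chi> i e. if e \<in> arcs G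
     then (if head G e = i then 1 else 0) - (if tail G e = i then 1 else 0) else 0)"

text \<open>
  The edges of the spanning tree \<open>T\<close> number \<open>n - 1\<close>, so the space of fundamental flows
  is the space of vectors indexed by \<open>T\<close>, realised as the subspace
  of those vectors in \<open>real^'e\<close> that vanish outside \<open>T\<close>.  In the same way the matrix \<open>K\<close>
  (rows indexed by the edges, columns by \<open>T\<close>) is padded with zeros, whereas the entries of the flow
  bounds outside the set of edges are never used.  With this encoding a network with
  a single node and no edges is included.

  The linear cycle constraints are \<open>\<Sum>e\<in>C. cycle_coeff C e * g $ e = 0\<close>, one for each undirected
  cycle \<open>C\<close>; in Kirchhoff's voltage law the coefficients are the line reactances, signed
  by the direction in which the cycle traverses the line.
\<close>

record ('n::finite, 'e::finite) opf =
  grid :: "('n, 'e) pre_digraph"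
  tree_edges :: "'e set"
  cycle_coeff :: "'e set \<Rightarrow> 'e \<Rightarrow> real"
  flow_map :: "real^'e^'e"
  unit_cost :: "real^'n"
  capacity :: "real^'n"
  flow_lo :: "real^'e"
  flow_hi :: "real^'e"

definition fund_flows :: "('n::finite, 'e::finite) opf \<Rightarrow> (real^'e) set" where
  "fund_flows N = {f. \<forall>e. e \<notin> tree_edges N \<longrightarrow> f $ e = 0}"

definition cycle_flows :: "('n::finite, 'e::finite) opf \<Rightarrow> (real^'e) set" where
  "cycle_flows N = {g. (\<forall>e. e \<notin> arcs (grid N) \<longrightarrow> g $ e = 0) \<and>
     (\<forall>C. undirected_cycle (grid N) C \<longrightarrow> (\<Sum>e\<in>C. cycle_coeff N C e * g $ e) = 0)}"

definition opf_network :: "('n::finite, 'e::finite) opf \<Rightarrow> bool" where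
  "opf_network N \<longleftrightarrow>
     verts (grid N) = UNIV \<and> loopfree_digraph (grid N) \<and>
     Digraph_Component.connected (grid N) \<and>
     undirected_spanning_tree (grid N) (tree_edges N) \<and>
     (\<forall>e t. e \<notin> arcs (grid N) \<or> t \<notin> tree_edges N \<longrightarrow> flow_map N $ e $ t = 0) \<and>
     (\<forall>e\<in>tree_edges N. \<forall>t\<in>tree_edges N. flow_map N $ e $ t = (if e = t then 1 else 0)) \<and>
     (\<lambda>f. flow_map N *v f) ` fund_flows N = cycle_flows N \<and>
     (\<forall>i. unit_cost N $ i > 0)"

definition mod_incidence :: "('n::finite, 'e::finite) opf \<Rightarrow> real^'e^'n" where
  "mod_incidence N = incidence (grid N) ** flow_map N"

definition feasible :: "('n::finite, 'e::finite) opf \<Rightarrow> real^'n \<Rightarrow> ((real^'n) \<times> (real^'e)) set" where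
  "feasible N l = {(x, f). f \<in> fund_flows N \<and> 0 \<le> x \<and> x \<le> capacity N \<and>
     (\<forall>e\<in>arcs (grid N). - flow_lo N $ e \<le> (flow_map N *v f) $ e \<and>
                        (flow_map N *v f) $ e \<le> flow_hi N $ e) \<and>
     x + mod_incidence N *v f = l}"

definition optimal :: "('n::finite, 'e::finite) opf \<Rightarrow> real^'n \<Rightarrow> (real^'n) \<times> (real^'e) \<Rightarrow> bool" where
  "optimal N l z \<longleftrightarrow> is_arg_min (\<lambda>(x, f). unit_cost N \<bullet> x) (\<lambda>z. z \<in> feasible N l) z"

text \<open>The value is meaningful only for those \<open>l\<close> for which the program is feasible.\<close>

definition opt_value :: "('n::finite, 'e::finite) opf \<Rightarrow> real^'n \<Rightarrow> real" where
  "opt_value N l = (INF (x, f) \<in> feasible N l. unit_cost N \<bullet> x)"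

text \<open>
  Dual variables are tuples (\<open>\<mu>\<close>, \<open>\<lambda>\<close> upper, \<open>\<lambda>\<close> lower, \<open>\<nu>\<close> lower, \<open>\<nu>\<close> upper).
\<close>

type_synonym ('n, 'e) dual = "(real^'n) \<times> (real^'e) \<times> (real^'e) \<times> (real^'n) \<times> (real^'n)"

fun lagrangian ::
  "('n::finite, 'e::finite) opf \<Rightarrow> real^'n \<Rightarrow> ('n, 'e) dual \<Rightarrow> (real^'n) \<times> (real^'e) \<Rightarrow> real" where
  "lagrangian N l (\<mu>, lam_hi, lam_lo, nu_lo, nu_hi) (x, f) =
     unit_cost N \<bullet> x + \<mu> \<bullet> (l - x - mod_incidence N *v f)
     + (\<Sum>e\<in>arcs (grid N). lam_hi $ e * ((flow_map N *v f) $ e - flow_hi N $ e))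
     - (\<Sum>e\<in>arcs (grid N). lam_lo $ e * ((flow_map N *v f) $ e + flow_lo N $ e))
     - nu_lo \<bullet> x + nu_hi \<bullet> (x - capacity N)"

definition dual_value :: "('n::finite, 'e::finite) opf \<Rightarrow> real^'n \<Rightarrow> ('n, 'e) dual \<Rightarrow> ereal" where
  "dual_value N l y = (INF z \<in> UNIV \<times> fund_flows N. ereal (lagrangian N l y z))"

fun dual_feasible :: "('n::finite, 'e::finite) dual \<Rightarrow> bool" where
  "dual_feasible (\<mu>, lam_hi, lam_lo, nu_lo, nu_hi) \<longleftrightarrow> 0 \<le> lam_hi \<and> 0 \<le> lam_lo \<and> 0 \<le> nu_lo \<and> 0 \<le> nu_hi"

definition dual_optimal :: "('n::finite, 'e::finite) opf \<Rightarrow> real^'n \<Rightarrow> ('n, 'e) dual \<Rightarrow> bool" where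
  "dual_optimal N l y \<longleftrightarrow> is_arg_max (dual_value N l) dual_feasible y"

datatype ('n, 'e) opf_constraint =
  Balance 'n | ProdLower 'n | ProdUpper 'n | FlowLower 'e | FlowUpper 'e

definition constraints :: "('n::finite, 'e::finite) opf \<Rightarrow> ('n, 'e) opf_constraint set" where
  "constraints N = range Balance \<union> range ProdLower \<union> range ProdUpper \<union>
     FlowLower ` arcs (grid N) \<union> FlowUpper ` arcs (grid N)"

text \<open>
  Coefficient vectors in the variables \<open>(x, f)\<close>; because of the zero padding, their \<open>f\<close>-parts are
  fundamental flows, so that independence in \<open>real^'n \<times> real^'e\<close> is independence in
  the \<open>(2 n - 1)\<close>-dimensional space of the program's variables.
\<close>

fun normal :: "('n::finite, 'e::finite) opf \<Rightarrow> ('n, 'e) opf_constraint \<Rightarrow> (real^'n) \<times> (real^'e)" where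
  "normal N (Balance i) = (axis i 1, mod_incidence N $ i)"
| "normal N (ProdLower i) = (- axis i 1, 0)"
| "normal N (ProdUpper i) = (axis i 1, 0)"
| "normal N (FlowLower e) = (0, - flow_map N $ e)"
| "normal N (FlowUpper e) = (0, flow_map N $ e)"

fun active ::
  "('n::finite, 'e::finite) opf \<Rightarrow> (real^'n) \<times> (real^'e) \<Rightarrow> ('n, 'e) opf_constraint \<Rightarrow> bool" where
  "active N (x, f) (Balance i) \<longleftrightarrow> True"
| "active N (x, f) (ProdLower i) \<longleftrightarrow> x $ i = 0"
| "active N (x, f) (ProdUpper i) \<longleftrightarrow> x $ i = capacity N $ i"
| "active N (x, f) (FlowLower e) \<longleftrightarrow> (flow_map N *v f) $ e = - flow_lo N $ e"
| "active N (x, f) (FlowUpper e) \<longleftrightarrow> (flow_map N *v f) $ e = flow_hi N $ e"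

definition active_set ::
  "('n::finite, 'e::finite) opf \<Rightarrow> (real^'n) \<times> (real^'e) \<Rightarrow> ('n, 'e) opf_constraint set" where
  "active_set N z = {k \<in> constraints N. active N z k}"

text \<open>
  Injectivity of \<open>normal N\<close> makes this linear independence of the family of active constraints,
  not just of the set of their coefficient vectors.
\<close>

definition nondegenerate :: "('n::finite, 'e::finite) opf \<Rightarrow> real^'n \<Rightarrow> bool" where
  "nondegenerate N l \<longleftrightarrow> (\<exists>!z. optimal N l z) \<and>
     (\<forall>z. optimal N l z \<longrightarrow>
        card (active_set N z) = 2 * CARD('n) - 1 \<and>
        inj_on (normal N) (active_set N z) \<and> independent (normal N ` active_set N z))"

end

theory Submission
  imports Defs
begin

text \<open>
  The result is a fact about linear programs; the network enters only through the constraint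
  normals. Let \<open>z\<close> be the unique optimal solution, and let the normals of the constraints active at
  \<open>z\<close> be linearly independent. Every direction \<open>d \<noteq> 0\<close> that
  violates no active constraint to first order can be followed from \<open>z\<close> for a short while, so by
  uniqueness the cost strictly increases along \<open>d\<close> (\<open>cost_increases\<close>). Apply this to the vectors
  \<open>e k\<close> of the basis dual to the active normals. Moving along \<open>- e k\<close> leaves one active inequality
  \<open>k\<close> and keeps all other active constraints tight, so \<open>- (c \<bullet> e k) > 0\<close>; a direction orthogonal to
  all active normals would make the cost increase both ways and is therefore zero, so the \<open>e k\<close>
  span the space of variables. The numbers \<open>- (c \<bullet> e k)\<close> are then Lagrange multipliers with
  a constant Lagrangian, equal to the optimal cost: this is strong duality (\<open>ex_multipliers\<close>).

  By strong duality, the Lagrangian of any optimal dual solution is bounded below by the optimal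
  cost. Being affine, it is constant, which gives stationarity and complementary slackness.
  Evaluating stationarity on \<open>e k\<close> shows that the multiplier of every active inequality
  is strictly positive (\<open>strict_complementarity\<close>).

  For the gradient, perturb the right-hand sides of the equations and correct \<open>z\<close> by the
  corresponding combination of the vectors \<open>e k\<close>. For small perturbations the result is feasible,
  and the old multipliers, still dual feasible, certify that it is
  optimal. Hence the optimal value is affine near the given right-hand side, with the negated
  multipliers as slopes (\<open>local_value\<close>).

  In the power flow program, stationarity in the variable \<open>x $ i\<close> reads
  \<open>\<mu> $ i - unit_cost N $ i = nu_hi $ i - nu_lo $ i\<close>, where by strict complementarity \<open>nu_hi $ i\<close> is
  positive exactly at full production and \<open>nu_lo $ i\<close> exactly at zero production. As the two bounds
  on \<open>x $ i\<close> have opposite normals, they are not both active, so the sign of the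
  difference determines which of them is active, if any.
\<close>

section \<open>Linear programs with a nondegenerate solution\<close>

text \<open>
  The variables range over a subspace rather than the whole type because the fundamental flows
  are the vectors of \<open>real^'e\<close> supported on the spanning tree. The right-hand side \<open>b\<close> is not
  a parameter, as the value of the program is studied as a function of it.
\<close>

locale linear_program =
  fixes V :: "'a::euclidean_space set"
    and E I :: "'k set"
    and a :: "'k \<Rightarrow> 'a"
    and c :: 'a
  assumes subspace_V: "subspace V"
    and finite_E: "finite E"
    and finite_I: "finite I"
    and disjoint: "E \<inter> I = {}"
    and normal_in_V: "\<And>k. k \<in> E \<union> I \<Longrightarrow> a k \<in> V"
begin

definition lp_feasible :: "('k \<Rightarrow> real) \<Rightarrow> 'a set" where
  "lp_feasible b = {w \<in> V. (\<forall>k\<in>E. a k \<bullet> w = b k) \<and> (\<forall>k\<in>I. a k \<bullet> w \<le> b k)}"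

definition lp_lagrangian :: "('k \<Rightarrow> real) \<Rightarrow> ('k \<Rightarrow> real) \<Rightarrow> 'a \<Rightarrow> real" where
  "lp_lagrangian b y w = c \<bullet> w + (\<Sum>k\<in>E \<union> I. y k * (a k \<bullet> w - b k))"

text \<open>
  Weak duality.
\<close>

lemma lagrangian_le_cost:
  assumes "w \<in> lp_feasible b" and "\<And>k. k \<in> I \<Longrightarrow> 0 \<le> y k"
  shows "lp_lagrangian b y w \<le> c \<bullet> w"
proof -
  have "(\<Sum>k\<in>E \<union> I. y k * (a k \<bullet> w - b k)) \<le> 0"
    using assms by (intro sum_nonpos) (auto simp: lp_feasible_def mult_nonneg_nonpos)
  then show ?thesis by (simp add: lp_lagrangian_def)
qed

text \<open>
  Linearly independent normals can be prescribed arbitrary values by a linear functional; the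
  vector that represents the functional is projected to \<open>V\<close>.
\<close>

lemma dual_basis:
  assumes "A \<subseteq> E \<union> I" "inj_on a A" "independent (a ` A)"
  obtains e where "\<And>k. k \<in> A \<Longrightarrow> e k \<in> V"
    and "\<And>j k. j \<in> A \<Longrightarrow> k \<in> A \<Longrightarrow> a j \<bullet> e k = (if j = k then 1 else 0)"
proof -
  have "\<exists>d\<in>V. \<forall>j\<in>A. a j \<bullet> d = (if j = k then 1 else 0)" if k: "k \<in> A" for k
  proof -
    obtain g :: "'a \<Rightarrow> real" where "linear g"
      and g: "\<forall>v\<in>a ` A. g v = (if v = a k then 1 else 0)"
      using linear_independent_extend[OF assms(3), of "\<lambda>v. if v = a k then 1 else 0"] by blast
    define u where "u = adjoint g 1"
    have u: "v \<bullet> u = g v" for v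
      using adjoint_works[OF \<open>linear g\<close>, of v 1] by (simp add: u_def)
    \<comment> \<open>The representing vector may leave \<open>V\<close>; projecting it back changes no product with
      the normals, as these lie in \<open>V\<close>.\<close>
    obtain d d' where d: "d \<in> span V" and d': "\<And>w. w \<in> span V \<Longrightarrow> orthogonal d' w" and "u = d + d'"
      using orthogonal_subspace_decomp_exists[of V u] by blast
    have "a j \<bullet> d = (if j = k then 1 else 0)" if j: "j \<in> A" for j
    proof -
      have "orthogonal d' (a j)"
        using d' normal_in_V assms(1) j by (blast intro: span_base)
      then have "a j \<bullet> d = a j \<bullet> u"
        using \<open>u = d + d'\<close> by (simp add: inner_add_right orthogonal_def inner_commute)
      also have "\<dots> = (if j = k then 1 else 0)"
        using u g j k assms(2) by (simp add: inj_on_eq_iff)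
      finally show ?thesis .
    qed
    moreover have "d \<in> V" using d subspace_V by (simp add: span_eq_iff[THEN iffD2])
    ultimately show ?thesis by blast
  qed
  then show ?thesis using that by metis
qed

end

text \<open>
  Injectivity on the active set makes the independence that of the family of normals: two active
  constraints with the same normal are excluded.
\<close>

locale nondegenerate_lp = linear_program +
  fixes b z
  assumes feasible_z: "z \<in> lp_feasible b"
    and unique_min: "\<And>w. w \<in> lp_feasible b \<Longrightarrow> w \<noteq> z \<Longrightarrow> c \<bullet> z < c \<bullet> w"
    and inj_active: "inj_on a {k \<in> E \<union> I. a k \<bullet> z = b k}"
    and independent_active: "independent (a ` {k \<in> E \<union> I. a k \<bullet> z = b k})"
begin

abbreviation act :: "'b set" where
  "act \<equiv> {k \<in> E \<union> I. a k \<bullet> z = b k}"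

lemma z_in_V: "z \<in> V" and E_subset_act: "E \<subseteq> act"
  using feasible_z by (auto simp: lp_feasible_def)

lemma finite_act: "finite act"
  using finite_E finite_I by simp

text \<open>
  Applied to the lower and the upper bound of one variable, this says that the bounds are not
  both attained.
\<close>

lemma active_not_opposite:
  assumes "j \<in> act" "k \<in> act"
  shows "a j \<noteq> - a k"
proof
  assume "a j = - a k"
  obtain e where "\<And>k. k \<in> act \<Longrightarrow> e k \<in> V"
    and e: "\<And>j k. j \<in> act \<Longrightarrow> k \<in> act \<Longrightarrow> a j \<bullet> e k = (if j = k then 1 else 0)"
    using dual_basis[OF _ inj_active independent_active] by blast
  have "a j \<bullet> e j = 1" "a k \<bullet> e j \<ge> 0"
    using e[OF assms(1) assms(1)] e[OF assms(2) assms(1)] by simp_all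
  then show False using \<open>a j = - a k\<close> by simp
qed

lemma eventually_inactive:
  assumes "(g \<longlongrightarrow> z) F"
  shows "eventually (\<lambda>p. \<forall>k\<in>I - act. a k \<bullet> g p < b k) F"
proof (rule eventually_ball_finite)
  show "finite (I - act)" using finite_I by simp
  show "\<forall>k\<in>I - act. eventually (\<lambda>p. a k \<bullet> g p < b k) F"
  proof
    fix k assume "k \<in> I - act"
    then have "a k \<bullet> z < b k"
      using feasible_z by (force simp: lp_feasible_def)
    then show "eventually (\<lambda>p. a k \<bullet> g p < b k) F"
      using order_tendstoD(2)[OF tendsto_inner[OF tendsto_const assms]] by blast
  qed
qed

text \<open>
  A short step from \<open>z\<close> along \<open>d\<close> stays feasible, because inactive constraints hold with slack
  at \<open>z\<close>. As \<open>z\<close> is the only minimiser, the step has a strictly positive cost.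
\<close>

lemma cost_increases:
  assumes "d \<in> V" "d \<noteq> 0"
    and E: "\<And>k. k \<in> E \<Longrightarrow> a k \<bullet> d = 0"
    and act: "\<And>k. k \<in> I \<inter> act \<Longrightarrow> a k \<bullet> d \<le> 0"
  shows "0 < c \<bullet> d"
proof -
  have "((\<lambda>t. z + t *\<^sub>R d) \<longlongrightarrow> z) (at_right (0::real))"
    by (auto intro!: tendsto_eq_intros)
  then have "eventually (\<lambda>t. 0 < t \<and> (\<forall>k\<in>I - act. a k \<bullet> (z + t *\<^sub>R d) < b k)) (at_right (0::real))"
    by (intro eventually_conj eventually_inactive eventually_at_right_less)
  then obtain t :: real where t: "0 < t" and inact: "\<And>k. k \<in> I - act \<Longrightarrow> a k \<bullet> (z + t *\<^sub>R d) < b k"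
    by (metis (no_types, lifting) eventually_happens trivial_limit_at_right_real)
  have "z + t *\<^sub>R d \<in> lp_feasible b"
    unfolding lp_feasible_def
  proof (intro CollectI conjI ballI)
    show "z + t *\<^sub>R d \<in> V"
      using subspace_V z_in_V \<open>d \<in> V\<close> by (simp add: subspace_add subspace_scale)
    show "a k \<bullet> (z + t *\<^sub>R d) = b k" if "k \<in> E" for k
      using that E E_subset_act by (auto simp: inner_add_right)
    show "a k \<bullet> (z + t *\<^sub>R d) \<le> b k" if "k \<in> I" for k
    proof (cases "k \<in> act")
      case True
      then show ?thesis
        using act[of k] that t by (auto simp: inner_add_right mult_le_0_iff)
    next
      case False
      then show ?thesis using inact[of k] that by auto
    qed
  qed
  then have "c \<bullet> z < c \<bullet> (z + t *\<^sub>R d)"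
    using unique_min t \<open>d \<noteq> 0\<close> by simp
  then show ?thesis using t by (simp add: inner_add_right zero_less_mult_iff)
qed

text \<open>
  For an inequality \<open>k\<close>, the vector \<open>- e k\<close> moves into the interior of \<open>k\<close> and along all other
  active constraints; it is an edge of the feasible region at the vertex \<open>z\<close>.
\<close>

lemma active_dual_basis:
  obtains e where "\<And>k. k \<in> act \<Longrightarrow> e k \<in> V"
    and "\<And>j k. j \<in> act \<Longrightarrow> k \<in> act \<Longrightarrow> a j \<bullet> e k = (if j = k then 1 else 0)"
    and "\<And>k. k \<in> I \<inter> act \<Longrightarrow> c \<bullet> e k < 0"
proof -
  obtain e where eV: "\<And>k. k \<in> act \<Longrightarrow> e k \<in> V"
    and e: "\<And>j k. j \<in> act \<Longrightarrow> k \<in> act \<Longrightarrow> a j \<bullet> e k = (if j = k then 1 else 0)"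
    using dual_basis[OF _ inj_active independent_active] by blast
  have "c \<bullet> e k < 0" if k: "k \<in> I \<inter> act" for k
  proof -
    have "k \<notin> E" using k disjoint by blast
    have "0 < c \<bullet> (- e k)"
    proof (rule cost_increases)
      show "- e k \<in> V" using eV k subspace_V by (simp add: subspace_neg)
      show "- e k \<noteq> 0" using e[of k k] k by auto
      show "a j \<bullet> (- e k) = 0" if "j \<in> E" for j
        using e[of j k] k \<open>k \<notin> E\<close> that E_subset_act by auto
      show "a j \<bullet> (- e k) \<le> 0" if "j \<in> I \<inter> act" for j
        using e[of j k] k that by auto
    qed
    then show ?thesis by simp
  qed
  then show ?thesis using that eV e by blast
qed

text \<open>
  Strong duality: these multipliers reach the optimal cost \<open>c \<bullet> z\<close>. That the active normals span
  \<open>V\<close>, so that \<open>c\<close> is a combination of them on \<open>V\<close>, follows from uniqueness of the minimiser.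
\<close>

lemma ex_multipliers:
  obtains y where "\<And>k. k \<in> I \<Longrightarrow> 0 \<le> y k" "\<And>w. w \<in> V \<Longrightarrow> lp_lagrangian b y w = c \<bullet> z"
proof -
  obtain e where eV: "\<And>k. k \<in> act \<Longrightarrow> e k \<in> V"
    and e: "\<And>j k. j \<in> act \<Longrightarrow> k \<in> act \<Longrightarrow> a j \<bullet> e k = (if j = k then 1 else 0)"
    and neg: "\<And>k. k \<in> I \<inter> act \<Longrightarrow> c \<bullet> e k < 0"
    using active_dual_basis by blast
  define y where "y k = (if k \<in> act then - (c \<bullet> e k) else 0)" for k
  have "0 \<le> y k" if "k \<in> I" for k
    using neg[of k] that by (auto simp: y_def)
  moreover have "lp_lagrangian b y w = c \<bullet> z" if "w \<in> V" for w
  proof -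
    define d where "d = (w - z) - (\<Sum>k\<in>act. (a k \<bullet> (w - z)) *\<^sub>R e k)"
    have dV: "d \<in> V"
      unfolding d_def using subspace_V that z_in_V eV
      by (intro subspace_diff subspace_sum subspace_scale) auto
    have orth: "a j \<bullet> d = 0" if "j \<in> act" for j
    proof -
      have "a j \<bullet> (\<Sum>k\<in>act. (a k \<bullet> (w - z)) *\<^sub>R e k) = (\<Sum>k\<in>act. if j = k then a k \<bullet> (w - z) else 0)"
        unfolding inner_sum_right using e[OF that] by (intro sum.cong) auto
      also have "\<dots> = a j \<bullet> (w - z)"
        using finite_act that by (subst sum.delta') auto
      finally show ?thesis by (simp add: d_def inner_diff_right)
    qed
    \<comment> \<open>Otherwise the cost would increase in both of the opposite directions \<open>d\<close> and \<open>- d\<close>.\<close>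
    have "d = 0"
    proof (rule ccontr)
      assume "d \<noteq> 0"
      have "0 < c \<bullet> d" "0 < c \<bullet> (- d)"
        using dV \<open>d \<noteq> 0\<close> orth E_subset_act subspace_V
        by (intro cost_increases; auto simp: subspace_neg)+
      then show False by simp
    qed
    then have "w - z = (\<Sum>k\<in>act. (a k \<bullet> (w - z)) *\<^sub>R e k)" by (simp add: d_def)
    then have "c \<bullet> (w - z) = c \<bullet> (\<Sum>k\<in>act. (a k \<bullet> (w - z)) *\<^sub>R e k)" by simp
    also have "\<dots> = (\<Sum>k\<in>act. - (y k * (a k \<bullet> (w - z))))"
      unfolding inner_sum_right by (intro sum.cong) (auto simp: y_def)
    also have "\<dots> = (\<Sum>k\<in>act. - (y k * (a k \<bullet> w - b k)))"
      by (intro sum.cong) (auto simp: inner_diff_right)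
    also have "\<dots> = - (\<Sum>k\<in>E \<union> I. y k * (a k \<bullet> w - b k))"
      unfolding sum_negf using finite_E finite_I
      by (intro arg_cong[where f = uminus] sum.mono_neutral_left) (auto simp: y_def)
    finally show ?thesis by (simp add: lp_lagrangian_def inner_diff_right)
  qed
  ultimately show ?thesis using that by blast
qed

text \<open>
  The second assumption says that the dual value of \<open>y\<close> is at least the optimal cost, which by
  strong duality is dual optimality.
\<close>

context
  fixes y
  assumes y_nonneg: "\<And>k. k \<in> I \<Longrightarrow> 0 \<le> y k"
    and y_optimal: "\<And>w. w \<in> V \<Longrightarrow> c \<bullet> z \<le> lp_lagrangian b y w"
begin

text \<open>
  At \<open>z\<close> all multiplier terms of the Lagrangian are nonpositive, yet their sum is nonnegative, so
  each of them vanishes.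
\<close>

lemma complementary_slackness:
  assumes "k \<in> I" "k \<notin> act"
  shows "y k = 0"
proof -
  have nonpos: "y j * (a j \<bullet> z - b j) \<le> 0" if "j \<in> E \<union> I" for j
    using that feasible_z y_nonneg by (auto simp: lp_feasible_def mult_nonneg_nonpos)
  have "0 \<le> (\<Sum>j\<in>E \<union> I. y j * (a j \<bullet> z - b j))"
    using y_optimal[OF z_in_V] by (simp add: lp_lagrangian_def)
  then have "(\<Sum>j\<in>E \<union> I. - (y j * (a j \<bullet> z - b j))) = 0"
    using nonpos by (intro antisym sum_nonneg) (auto simp: sum_negf)
  then have "y k * (a k \<bullet> z - b k) = 0"
    using nonpos assms(1) finite_E finite_I by (subst (asm) sum_nonneg_eq_0_iff) auto
  then show ?thesis using assms by auto
qed

text \<open>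
  An affine function that is bounded below on a subspace is constant there.
\<close>

lemma stationarity:
  assumes "d \<in> V"
  shows "c \<bullet> d + (\<Sum>k\<in>E \<union> I. y k * (a k \<bullet> d)) = 0"
proof -
  define s where "s = c \<bullet> d + (\<Sum>k\<in>E \<union> I. y k * (a k \<bullet> d))"
  have Lz: "lp_lagrangian b y z = c \<bullet> z"
    using y_nonneg by (intro antisym y_optimal[OF z_in_V] lagrangian_le_cost[OF feasible_z])
  have L: "lp_lagrangian b y (z + t *\<^sub>R d) = c \<bullet> z + t * s" for t
  proof -
    have "lp_lagrangian b y (z + t *\<^sub>R d) = lp_lagrangian b y z + t * s"
      by (simp add: lp_lagrangian_def s_def algebra_simps inner_add_right sum.distrib
          sum_distrib_left sum_subtractf)
    then show ?thesis using Lz by simp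
  qed
  have "z + t *\<^sub>R d \<in> V" for t
    using subspace_V z_in_V assms by (simp add: subspace_add subspace_scale)
  then have "0 \<le> t * s" for t using y_optimal[of "z + t *\<^sub>R d"] L by simp
  \<comment> \<open>The choice \<open>t = - s\<close> makes the increment \<open>- s\<^sup>2\<close>.\<close>
  from this[of "- s"] have "s = 0"
    by (metis add.inverse_inverse minus_mult_left mult_eq_0_iff neg_0_le_iff_le antisym zero_le_square)
  then show ?thesis by (simp add: s_def)
qed

lemma stationarity_active:
  assumes "d \<in> V"
  shows "c \<bullet> d = - (\<Sum>k\<in>act. y k * (a k \<bullet> d))"
proof -
  have "(\<Sum>k\<in>E \<union> I. y k * (a k \<bullet> d)) = (\<Sum>k\<in>act. y k * (a k \<bullet> d))"
    using finite_E finite_I E_subset_act complementary_slackness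
    by (intro sum.mono_neutral_right) auto
  then show ?thesis using stationarity[OF assms] by simp
qed

text \<open>
  Stationarity in the direction \<open>e k\<close> identifies the multiplier as \<open>- (c \<bullet> e k)\<close>.
\<close>

lemma strict_complementarity:
  assumes "k \<in> I" "k \<in> act"
  shows "0 < y k"
proof -
  obtain e where eV: "\<And>k. k \<in> act \<Longrightarrow> e k \<in> V"
    and e: "\<And>j k. j \<in> act \<Longrightarrow> k \<in> act \<Longrightarrow> a j \<bullet> e k = (if j = k then 1 else 0)"
    and neg: "\<And>k. k \<in> I \<inter> act \<Longrightarrow> c \<bullet> e k < 0"
    using active_dual_basis by blast
  have "c \<bullet> e k = - (\<Sum>j\<in>act. y j * (a j \<bullet> e k))"
    by (rule stationarity_active[OF eV[OF assms(2)]])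
  also have "(\<Sum>j\<in>act. y j * (a j \<bullet> e k)) = (\<Sum>j\<in>act. if j = k then y j else 0)"
    using e[OF _ assms(2)] by (intro sum.cong) auto
  also have "\<dots> = y k" using finite_act assms(2) by (subst sum.delta) auto
  finally show ?thesis using neg[of k] assms by simp
qed

text \<open>
  Sensitivity of the value to the right-hand sides \<open>\<beta> p k\<close> of the equations. Moving \<open>z\<close> by
  \<open>\<Sum>k\<in>E. (\<beta> p k - b k) *\<^sub>R e k\<close> restores the equations and keeps the active inequalities tight;
  the Lagrangian of \<open>y\<close> with the new right-hand side bounds the cost of every feasible point from
  below by the cost of the moved point.
\<close>

lemma local_value:
  fixes \<beta> :: "'p \<Rightarrow> 'b \<Rightarrow> real"
  assumes lim: "\<And>k. k \<in> E \<Longrightarrow> ((\<lambda>p. \<beta> p k) \<longlongrightarrow> b k) F"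
    and same: "\<And>p k. k \<in> I \<Longrightarrow> \<beta> p k = b k"
  shows "eventually (\<lambda>p. (INF w\<in>lp_feasible (\<beta> p). c \<bullet> w) = c \<bullet> z - (\<Sum>k\<in>E. y k * (\<beta> p k - b k))) F"
proof -
  obtain e where eV: "\<And>k. k \<in> act \<Longrightarrow> e k \<in> V"
    and e: "\<And>j k. j \<in> act \<Longrightarrow> k \<in> act \<Longrightarrow> a j \<bullet> e k = (if j = k then 1 else 0)"
    using dual_basis[OF _ inj_active independent_active] by blast
  define h where "h p = (\<Sum>k\<in>E. (\<beta> p k - b k) *\<^sub>R e k)" for p
  have hV: "h p \<in> V" for p
    unfolding h_def using subspace_V eV E_subset_act by (intro subspace_sum subspace_scale) auto
  have ah: "a j \<bullet> h p = (if j \<in> E then \<beta> p j - b j else 0)" if "j \<in> act" for j p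
  proof -
    have "a j \<bullet> h p = (\<Sum>k\<in>E. if j = k then \<beta> p k - b k else 0)"
      unfolding h_def inner_sum_right using e[OF that] E_subset_act by (intro sum.cong) auto
    also have "\<dots> = (if j \<in> E then \<beta> p j - b j else 0)"
      using finite_E by (subst sum.delta') auto
    finally show ?thesis .
  qed
  have cost: "c \<bullet> (z + h p) = c \<bullet> z - (\<Sum>k\<in>E. y k * (\<beta> p k - b k))" for p
  proof -
    have "(\<Sum>k\<in>act. y k * (a k \<bullet> h p)) = (\<Sum>k\<in>E. y k * (\<beta> p k - b k))"
      using finite_act E_subset_act ah by (intro sum.mono_neutral_cong_right) auto
    then show ?thesis using stationarity_active[OF hV[of p]] by (simp add: inner_add_right)
  qed
  have "((\<lambda>p. z + h p) \<longlongrightarrow> z + (\<Sum>k\<in>E. (b k - b k) *\<^sub>R e k)) F"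
    unfolding h_def by (intro tendsto_intros lim)
  then have "eventually (\<lambda>p. \<forall>k\<in>I - act. a k \<bullet> (z + h p) < b k) F"
    by (intro eventually_inactive) simp
  then show ?thesis
  proof eventually_elim
    case (elim p)
    have feas: "z + h p \<in> lp_feasible (\<beta> p)"
      unfolding lp_feasible_def
    proof (intro CollectI conjI ballI)
      show "z + h p \<in> V" using subspace_V z_in_V hV by (simp add: subspace_add)
      show "a k \<bullet> (z + h p) = \<beta> p k" if "k \<in> E" for k
        using ah[of k p] that E_subset_act by (auto simp: inner_add_right)
      show "a k \<bullet> (z + h p) \<le> \<beta> p k" if "k \<in> I" for k
      proof (cases "k \<in> act")
        case True
        moreover have "k \<notin> E" using that disjoint by blast
        ultimately show ?thesis using ah[of k p] same[OF that] by (auto simp: inner_add_right)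
      next
        case False
        then show ?thesis using elim that same[OF that] by force
      qed
    qed
    have lower: "c \<bullet> (z + h p) \<le> c \<bullet> w" if w: "w \<in> lp_feasible (\<beta> p)" for w
    proof -
      have split: "(\<Sum>k\<in>E \<union> I. g k) = (\<Sum>k\<in>E. g k) + (\<Sum>k\<in>I. g k)" for g :: "'b \<Rightarrow> real"
        using finite_E finite_I disjoint by (simp add: sum.union_disjoint)
      have "c \<bullet> z \<le> lp_lagrangian b y w"
        using y_optimal w by (simp add: lp_feasible_def)
      moreover have "lp_lagrangian (\<beta> p) y w = lp_lagrangian b y w - (\<Sum>k\<in>E. y k * (\<beta> p k - b k))"
        unfolding lp_lagrangian_def split
        by (simp add: same algebra_simps sum.distrib sum_subtractf)
      moreover have "lp_lagrangian (\<beta> p) y w \<le> c \<bullet> w"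
        using lagrangian_le_cost[OF w] y_nonneg by blast
      ultimately show ?thesis unfolding cost by linarith
    qed
    have "(INF w\<in>lp_feasible (\<beta> p). c \<bullet> w) = c \<bullet> (z + h p)"
      using feas lower by (intro cInf_eq_minimum) auto
    then show ?case by (simp only: cost)
  qed
qed

end

end


section \<open>Optimal power flow as a linear program\<close>

definition inequalities :: "('n::finite, 'e::finite) opf \<Rightarrow> ('n, 'e) opf_constraint set" where
  "inequalities N = range ProdLower \<union> range ProdUpper \<union>
     FlowLower ` arcs (grid N) \<union> FlowUpper ` arcs (grid N)"

text \<open>
  The inequalities are read in the form \<open>normal N k \<bullet> z \<le> bound N l k\<close>, with outward normals. For
  lower bounds both sides are therefore negated.
\<close>

fun bound :: "('n::finite, 'e::finite) opf \<Rightarrow> real^'n \<Rightarrow> ('n, 'e) opf_constraint \<Rightarrow> real" where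
  "bound N l (Balance i) = l $ i"
| "bound N l (ProdLower i) = 0"
| "bound N l (ProdUpper i) = capacity N $ i"
| "bound N l (FlowLower e) = flow_lo N $ e"
| "bound N l (FlowUpper e) = flow_hi N $ e"

text \<open>
  The sign of \<open>\<mu>\<close> is reversed because the Lagrangian multiplies \<open>\<mu>\<close> with load minus supply, whereas
  the equality constraint with normal \<open>normal N (Balance i)\<close> has supply minus load as residual.
\<close>

fun multiplier :: "('n::finite, 'e::finite) dual \<Rightarrow> ('n, 'e) opf_constraint \<Rightarrow> real" where
  "multiplier (\<mu>, lam_hi, lam_lo, nu_lo, nu_hi) (Balance i) = - \<mu> $ i"
| "multiplier (\<mu>, lam_hi, lam_lo, nu_lo, nu_hi) (ProdLower i) = nu_lo $ i"
| "multiplier (\<mu>, lam_hi, lam_lo, nu_lo, nu_hi) (ProdUpper i) = nu_hi $ i"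
| "multiplier (\<mu>, lam_hi, lam_lo, nu_lo, nu_hi) (FlowLower e) = lam_lo $ e"
| "multiplier (\<mu>, lam_hi, lam_lo, nu_lo, nu_hi) (FlowUpper e) = lam_hi $ e"

lemma constraints_eq: "constraints N = range Balance \<union> inequalities N"
  by (auto simp: constraints_def inequalities_def)

lemma inner_axis_left: "axis i 1 \<bullet> (x :: real^'n::finite) = x $ i"
  by (simp add: inner_commute inner_axis)

lemma normal_inner:
  "normal N (Balance i) \<bullet> (x, f) = (x + mod_incidence N *v f) $ i"
  "normal N (ProdLower i) \<bullet> (x, f) = - x $ i"
  "normal N (ProdUpper i) \<bullet> (x, f) = x $ i"
  "normal N (FlowLower e) \<bullet> (x, f) = - (flow_map N *v f) $ e"
  "normal N (FlowUpper e) \<bullet> (x, f) = (flow_map N *v f) $ e"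
  by (simp_all add: inner_axis_left matrix_vector_mul_component)

lemma active_iff_tight:
  assumes "z \<in> feasible N l" "k \<in> constraints N"
  shows "active N z k \<longleftrightarrow> normal N k \<bullet> z = bound N l k"
proof (cases z)
  case (Pair x f)
  then show ?thesis
    using assms by (cases k) (auto simp: normal_inner feasible_def simp del: normal.simps)
qed

text \<open>
  The flow parts of all normals are fundamental flows because the columns of the flow map outside the
  spanning tree vanish.
\<close>

lemma linear_program_opf:
  assumes "opf_network N"
  shows "linear_program (UNIV \<times> fund_flows N) (range Balance) (inequalities N) (normal N)"
proof
  show "subspace (UNIV \<times> fund_flows N :: ((real^'a) \<times> (real^'b)) set)"
    by (auto simp: subspace_def fund_flows_def zero_prod_def)
  have cols: "flow_map N $ e $ t = 0" if "t \<notin> tree_edges N" for e t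
    using assms that by (auto simp: opf_network_def)
  then have "mod_incidence N $ i $ t = 0" if "t \<notin> tree_edges N" for i t
    using that by (simp add: mod_incidence_def matrix_matrix_mult_def)
  then show "normal N k \<in> UNIV \<times> fund_flows N" for k
    using cols by (cases k) (auto simp: fund_flows_def)
qed (auto simp: inequalities_def)

lemma feasible_eq_lp_feasible:
  assumes "opf_network N"
  shows "feasible N l = linear_program.lp_feasible (UNIV \<times> fund_flows N) (range Balance)
    (inequalities N) (normal N) (bound N l)"
  unfolding linear_program.lp_feasible_def[OF linear_program_opf[OF assms]]
  by (auto simp: feasible_def inequalities_def normal_inner less_eq_vec_def vec_eq_iff minus_le_iff
      ball_Un simp del: normal.simps)

lemma opt_value_eq:
  "opt_value N l = (INF w\<in>feasible N l. (unit_cost N, 0) \<bullet> w)"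
  by (auto simp: opt_value_def intro!: arg_cong[where f = Inf] image_cong)

lemma sum_constraints:
  fixes g :: "('n::finite, 'e::finite) opf_constraint \<Rightarrow> real"
  shows "(\<Sum>k\<in>range Balance \<union> inequalities N. g k) =
    (\<Sum>i\<in>UNIV. g (Balance i)) + (\<Sum>i\<in>UNIV. g (ProdLower i)) + (\<Sum>i\<in>UNIV. g (ProdUpper i))
    + (\<Sum>e\<in>arcs (grid N). g (FlowLower e)) + (\<Sum>e\<in>arcs (grid N). g (FlowUpper e))"
proof -
  have inj: "inj_on Balance S" "inj_on ProdLower S" "inj_on ProdUpper S"
    "inj_on FlowLower S'" "inj_on FlowUpper S'" for S :: "'n set" and S' :: "'e set"
    by (auto simp: inj_on_def)
  have "(\<Sum>k\<in>range Balance \<union> inequalities N. g k) =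
    (\<Sum>k\<in>range Balance. g k) + (\<Sum>k\<in>range ProdLower. g k) + (\<Sum>k\<in>range ProdUpper. g k)
    + (\<Sum>k\<in>FlowLower ` arcs (grid N). g k) + (\<Sum>k\<in>FlowUpper ` arcs (grid N). g k)"
    unfolding inequalities_def Un_assoc[symmetric]
    by (subst sum.union_disjoint, simp, simp, force)+ (rule refl)
  then show ?thesis by (simp add: sum.reindex inj)
qed

lemma lagrangian_eq_lp_lagrangian:
  assumes "opf_network N"
  shows "lagrangian N l y z =
    linear_program.lp_lagrangian (range Balance) (inequalities N) (normal N) (unit_cost N, 0)
      (bound N l) (multiplier y) z"
proof -
  obtain \<mu> lam_hi lam_lo nu_lo nu_hi x f
    where y: "y = (\<mu>, lam_hi, lam_lo, nu_lo, nu_hi)" and z: "z = (x, f)"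
    by (metis prod_cases5 surj_pair)
  have "\<mu> \<bullet> (l - x - mod_incidence N *v f) =
      (\<Sum>i\<in>UNIV. - \<mu> $ i * ((x + mod_incidence N *v f) $ i - l $ i))"
    unfolding inner_vec_def by (intro sum.cong) (auto simp: algebra_simps)
  moreover have "- (nu_lo \<bullet> x) = (\<Sum>i\<in>UNIV. nu_lo $ i * (- x $ i - 0))"
    by (simp add: inner_vec_def sum_negf)
  moreover have "nu_hi \<bullet> (x - capacity N) = (\<Sum>i\<in>UNIV. nu_hi $ i * (x $ i - capacity N $ i))"
    by (simp add: inner_vec_def)
  moreover have "- (\<Sum>e\<in>arcs (grid N). lam_lo $ e * ((flow_map N *v f) $ e + flow_lo N $ e)) =
      (\<Sum>e\<in>arcs (grid N). lam_lo $ e * (- (flow_map N *v f) $ e - flow_lo N $ e))"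
    unfolding sum_negf[symmetric] by (intro sum.cong) (auto simp: algebra_simps)
  ultimately show ?thesis
    unfolding linear_program.lp_lagrangian_def[OF linear_program_opf[OF assms]] sum_constraints
    unfolding y z lagrangian.simps multiplier.simps bound.simps normal_inner by simp
qed

lemma optimal_iff:
  "optimal N l z \<longleftrightarrow> z \<in> feasible N l \<and>
    (\<forall>w\<in>feasible N l. (unit_cost N, 0) \<bullet> z \<le> (unit_cost N, 0) \<bullet> w)"
  by (cases z) (force simp: optimal_def is_arg_min_def)

text \<open>
  Another point of the same cost as \<open>z\<close> would be a second optimal solution, so uniqueness makes
  the minimum at \<open>z\<close> strict.
\<close>

lemma nondegenerate_lp_opf:
  assumes "opf_network N" "nondegenerate N l" "optimal N l z"
  shows "nondegenerate_lp (UNIV \<times> fund_flows N) (range Balance) (inequalities N) (normal N)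
    (unit_cost N, 0) (bound N l) z"
proof -
  have feas: "z \<in> feasible N l" using assms(3) by (simp add: optimal_iff)
  have tight: "{k \<in> range Balance \<union> inequalities N. normal N k \<bullet> z = bound N l k} = active_set N z"
    unfolding active_set_def constraints_eq[symmetric] using active_iff_tight[OF feas] by blast
  have less: "(unit_cost N, 0) \<bullet> z < (unit_cost N, 0) \<bullet> w" if "w \<in> feasible N l" "w \<noteq> z" for w
  proof -
    have "\<not> optimal N l w" using assms(2,3) that(2) by (auto simp: nondegenerate_def)
    then show ?thesis using assms(3) that(1) unfolding optimal_iff by fastforce
  qed
  have "inj_on (normal N) (active_set N z) \<and> independent (normal N ` active_set N z)"
    using assms(2,3) unfolding nondegenerate_def by blast
  then show ?thesis
    unfolding nondegenerate_lp_def nondegenerate_lp_axioms_def tight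
      feasible_eq_lp_feasible[OF assms(1), symmetric]
    using linear_program_opf[OF assms(1)] feas less by blast
qed

text \<open>
  The multipliers of \<open>ex_multipliers\<close>, read as a dual solution, attain the optimal cost; a dual
  optimal \<open>y\<close> does at least as well.
\<close>

lemma cost_le_lagrangian:
  assumes "opf_network N" "nondegenerate N l" "optimal N l z" "dual_optimal N l y"
    and w: "w \<in> UNIV \<times> fund_flows N"
  shows "(unit_cost N, 0) \<bullet> z \<le> lagrangian N l y w"
proof -
  interpret nondegenerate_lp "UNIV \<times> fund_flows N" "range Balance" "inequalities N" "normal N"
    "(unit_cost N, 0)" "bound N l" z
    by (rule nondegenerate_lp_opf) fact+
  obtain m where nonneg: "\<And>k. k \<in> inequalities N \<Longrightarrow> 0 \<le> m k"
    and m: "\<And>w. w \<in> UNIV \<times> fund_flows N \<Longrightarrow> lp_lagrangian (bound N l) m w = (unit_cost N, 0) \<bullet> z"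
    using ex_multipliers by blast
  define y' :: "('a, 'b) dual" where "y' = (\<chi> i. - m (Balance i),
    \<chi> e. if e \<in> arcs (grid N) then m (FlowUpper e) else 0,
    \<chi> e. if e \<in> arcs (grid N) then m (FlowLower e) else 0,
    \<chi> i. m (ProdLower i), \<chi> i. m (ProdUpper i))"
  have "dual_feasible y'"
    using nonneg by (auto simp: y'_def less_eq_vec_def inequalities_def)
  have "multiplier y' k = m k" if "k \<in> range Balance \<union> inequalities N" for k
    using that by (auto simp: y'_def inequalities_def)
  then have "lagrangian N l y' v = (unit_cost N, 0) \<bullet> z" if "v \<in> UNIV \<times> fund_flows N" for v
    unfolding m[OF that, symmetric] lagrangian_eq_lp_lagrangian[OF assms(1)] lp_lagrangian_def
    by (auto intro!: sum.cong)
  then have "ereal ((unit_cost N, 0) \<bullet> z) \<le> dual_value N l y'"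
    unfolding dual_value_def by (intro INF_greatest) simp
  also have "\<dots> \<le> dual_value N l y"
    using assms(4) \<open>dual_feasible y'\<close> unfolding dual_optimal_def is_arg_max_def by (meson not_less)
  also have "\<dots> \<le> ereal (lagrangian N l y w)"
    unfolding dual_value_def by (intro INF_lower w)
  finally show ?thesis by simp
qed

section \<open>Nodal prices\<close>

theorem theorem2:
  fixes N :: "('n::finite, 'e::finite) opf"
    and l x \<mu> nu_lo nu_hi :: "real^'n"
    and f lam_hi lam_lo :: "real^'e"
  assumes "opf_network N"
    and "feasible N l \<noteq> {}"
    and "nondegenerate N l"
    and "optimal N l (x, f)"
    and "dual_optimal N l (\<mu>, lam_hi, lam_lo, nu_lo, nu_hi)"
  shows "(GDERIV (opt_value N) l :> \<mu>) \<and>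
    (\<forall>i. (\<mu> $ i - unit_cost N $ i > 0 \<longrightarrow> x $ i = capacity N $ i) \<and>
         (\<mu> $ i - unit_cost N $ i < 0 \<longrightarrow> x $ i = 0) \<and>
         (\<mu> $ i - unit_cost N $ i = 0 \<longrightarrow> x $ i \<in> {0<..<capacity N $ i}))"
proof -
  let ?y = "(\<mu>, lam_hi, lam_lo, nu_lo, nu_hi)"
  interpret nondegenerate_lp "UNIV \<times> fund_flows N" "range Balance" "inequalities N" "normal N"
    "(unit_cost N, 0)" "bound N l" "(x, f)"
    by (rule nondegenerate_lp_opf) fact+
  have nonneg: "0 \<le> multiplier ?y k" if "k \<in> inequalities N" for k
    using assms(5) that
    by (auto simp: dual_optimal_def is_arg_max_def less_eq_vec_def inequalities_def)
  have opt: "(unit_cost N, 0) \<bullet> (x, f) \<le> lp_lagrangian (bound N l) (multiplier ?y) w"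
    if "w \<in> UNIV \<times> fund_flows N" for w
    using cost_le_lagrangian[OF assms(1,3,4,5) that]
    by (simp only: lagrangian_eq_lp_lagrangian[OF assms(1)])
  have slack: "multiplier ?y k = 0" if "k \<in> inequalities N" "normal N k \<bullet> (x, f) \<noteq> bound N l k" for k
    using complementary_slackness[of "multiplier ?y" k] nonneg opt that by blast
  have strict: "0 < multiplier ?y k" if "k \<in> inequalities N" "normal N k \<bullet> (x, f) = bound N l k" for k
    using strict_complementarity[of "multiplier ?y" k] nonneg opt that by blast

  have load_change: "(\<Sum>k\<in>range Balance. multiplier ?y k * (bound N l' k - bound N l k)) = - (\<mu> \<bullet> (l' - l))" for l'
    by (simp add: sum.reindex inj_on_def inner_vec_def sum_negf)
  have "eventually (\<lambda>l'. (INF w\<in>lp_feasible (bound N l'). (unit_cost N, 0) \<bullet> w) =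
      (unit_cost N, 0) \<bullet> (x, f)
      - (\<Sum>k\<in>range Balance. multiplier ?y k * (bound N l' k - bound N l k))) (nhds l)"
  proof (rule local_value[OF nonneg opt])
    show "((\<lambda>l'. bound N l' k) \<longlongrightarrow> bound N l k) (nhds l)" if "k \<in> range Balance" for k
      using that by (auto intro!: tendsto_vec_nth filterlim_ident)
    show "bound N l' k = bound N l k" if "k \<in> inequalities N" for l' k
      using that by (auto simp: inequalities_def)
  qed
  then have near: "eventually (\<lambda>l'. unit_cost N \<bullet> x + \<mu> \<bullet> (l' - l) = opt_value N l') (nhds l)"
  proof eventually_elim
    case (elim l')
    then show ?case
      unfolding load_change opt_value_eq feasible_eq_lp_feasible[OF assms(1)] by simp
  qed
  have "((\<lambda>l'. unit_cost N \<bullet> x + \<mu> \<bullet> (l' - l)) has_derivative (\<lambda>h. h \<bullet> \<mu>)) (at l)"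
    by (auto intro!: derivative_eq_intros simp: inner_commute)
  moreover have "eventually (\<lambda>l'. unit_cost N \<bullet> x + \<mu> \<bullet> (l' - l) = opt_value N l') (at l)"
    using near by (simp add: eventually_at_filter eventually_mono)
  ultimately have "GDERIV (opt_value N) l :> \<mu>"
    unfolding gderiv_def
    using eventually_nhds_x_imp_x[OF near] by (rule has_derivative_transform_eventually) simp
  moreover have "(\<mu> $ i - unit_cost N $ i > 0 \<longrightarrow> x $ i = capacity N $ i) \<and>
         (\<mu> $ i - unit_cost N $ i < 0 \<longrightarrow> x $ i = 0) \<and>
         (\<mu> $ i - unit_cost N $ i = 0 \<longrightarrow> x $ i \<in> {0<..<capacity N $ i})" for i
  proof -
    have axis_component: "axis i (1::real) $ j = (if j = i then 1 else 0)" for j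
      by (simp add: axis_def)
    \<comment> \<open>Stationarity of the Lagrangian in the production at node \<open>i\<close>.\<close>
    have "(axis i 1, 0) \<in> UNIV \<times> fund_flows N" by (simp add: fund_flows_def)
    from stationarity[OF nonneg opt this]
    have price: "\<mu> $ i - unit_cost N $ i = nu_hi $ i - nu_lo $ i"
      unfolding sum_constraints
      by (simp add: normal_inner inner_axis axis_component if_distrib cong: if_cong
          del: normal.simps)
    have lower: "ProdLower i \<in> inequalities N" and upper: "ProdUpper i \<in> inequalities N"
      by (auto simp: inequalities_def)
    have lo: "if x $ i = 0 then 0 < nu_lo $ i else nu_lo $ i = 0"
      using slack[OF lower] strict[OF lower] by (simp add: normal_inner del: normal.simps)
    have hi: "if x $ i = capacity N $ i then 0 < nu_hi $ i else nu_hi $ i = 0"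
      using slack[OF upper] strict[OF upper] by (simp add: normal_inner del: normal.simps)
    have "\<not> (x $ i = 0 \<and> x $ i = capacity N $ i)"
      using active_not_opposite[of "ProdLower i" "ProdUpper i"] lower upper
      by (auto simp: inner_axis_left)
    moreover have "0 \<le> x $ i" "x $ i \<le> capacity N $ i"
      using assms(4) by (auto simp: optimal_iff feasible_def less_eq_vec_def)
    ultimately show ?thesis using price lo hi by (auto split: if_splits)
  qed
  ultimately show ?thesis by blast
qed

end
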